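(* Let $Q\in\mathbb{H}[s,t]$ be primitive and of bidegree $(1,1)$. Then the following are equivalent: (i) There exist $p,q\in\mathbb{C}\setminus\mathbb{R}$ such that $[Q(s,p)]\subset\mathcal{N}$ and $[Q(q,t)]\subset\mathcal{N}$ are contained in complex lines. (ii) $Q\in\{S\cdot T,\,T\cdot S\}$ for some linear polynomials $S\in\mathbb{H}[s]$ and $T\in\mathbb{H}[t]$. (iii) $Q\cdot Q^*=A\cdot B$ for some quadratic polynomials $A\in\mathbb{R}[s]$ and $B\in\mathbb{R}[t]$.
   Context: $\mathbb{H}=\langle 1,\mathbf{i},\mathbf{j},\mathbf{k}\rangle_{\mathbb{R}}$ denotes the quaternions and $\mathbb{H}_{\mathbb{C}}=\mathbb{H}\otimes_{\mathbb{R}}\mathbb{C}\cong\mathbb{C}^4$ the complex quaternions (the imaginary unit of $\mathbb{C}$ is central and different from $\mathbf{i}$). The conjugate of $h=h_1+h_2\mathbf{i}+h_3\mathbf{j}+h_4\mathbf{k}$ is $h^*=h_1-h_2\mathbf{i}-h_3\mathbf{j}-h_4\mathbf{k}$; the conjugate $Q^*$ of a polynomial is obtained by conjugating its coefficients. In $\mathbb{H}_{\mathbb{C}}[s,t]\supset\mathbb{H}[s,t]$ the variables commute with each other and with the coefficients. $Q$ is primitive if it is not of the form $P\cdot\tilde{Q}$ with $P\in\mathbb{C}[s,t]$ non-constant and $\tilde Q\in\mathbb{H}_{\mathbb{C}}[s,t]$. For a non-zero polynomial $R$ with coefficients in $\mathbb{H}_{\mathbb{C}}$, $[R]\subset\mathbb{P}^3$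 denotes the Zariski closure, in the complex projective space $\mathbb{P}^3=\mathbb{P}(\mathbb{H}_{\mathbb{C}})$, of the projectivization of the set of its non-zero values at complex arguments; e.g. $[Q(s,p)]$ is the closure of $\{Q(s,p)\mid s\in\mathbb{C}\}$ in $\mathbb{P}^3$. The null quadric is $\mathcal{N}=\{x\in\mathbb{P}^3\mid x_0^2+x_1^2+x_2^2+x_3^2=0\}$, i.e. the projectivization of $\{h\in\mathbb{H}_{\mathbb{C}}\mid h\cdot h^*=0\}$. *)

theory Defs
  imports "HOL-Analysis.Analysis" "HOL-Library.Poly_Mapping" "HOL-Library.Product_Plus"
begin

section \<open>Quaternions over a commutative ring\<close>

text \<open>
  The type \<open>real quat\<close> is the skew field of quaternions; \<open>complex quat\<close> is its
  complexification, the scalar extension acting coordinatewise. The imaginary unit of the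
  coefficient ring is thus central and different from \<open>quat_i\<close>.
\<close>

datatype 'a quat = Quat (q1: 'a) (q2: 'a) (q3: 'a) (q4: 'a)

instantiation quat :: (comm_ring_1) ring_1
begin

definition zero_quat :: "'a quat" where
  "0 = Quat 0 0 0 0"

definition one_quat :: "'a quat" where
  "1 = Quat 1 0 0 0"

definition plus_quat :: "'a quat \<Rightarrow> 'a quat \<Rightarrow> 'a quat" where
  "x + y = Quat (q1 x + q1 y) (q2 x + q2 y) (q3 x + q3 y) (q4 x + q4 y)"

definition minus_quat :: "'a quat \<Rightarrow> 'a quat \<Rightarrow> 'a quat" where
  "x - y = Quat (q1 x - q1 y) (q2 x - q2 y) (q3 x - q3 y) (q4 x - q4 y)"

definition uminus_quat :: "'a quat \<Rightarrow> 'a quat" where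
  "- x = Quat (- q1 x) (- q2 x) (- q3 x) (- q4 x)"

definition times_quat :: "'a quat \<Rightarrow> 'a quat \<Rightarrow> 'a quat" where
  "x * y = Quat
     (q1 x * q1 y - q2 x * q2 y - q3 x * q3 y - q4 x * q4 y)
     (q1 x * q2 y + q2 x * q1 y + q3 x * q4 y - q4 x * q3 y)
     (q1 x * q3 y - q2 x * q4 y + q3 x * q1 y + q4 x * q2 y)
     (q1 x * q4 y + q2 x * q3 y - q3 x * q2 y + q4 x * q1 y)"

instance
  by standard
    (simp_all add: zero_quat_def one_quat_def plus_quat_def minus_quat_def uminus_quat_def
       times_quat_def quat.expand algebra_simps)

end

definition quat_i :: "'a::comm_ring_1 quat" where "quat_i = Quat 0 1 0 0"
definition quat_j :: "'a::comm_ring_1 quat" where "quat_j = Quat 0 0 1 0"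
definition quat_k :: "'a::comm_ring_1 quat" where "quat_k = Quat 0 0 0 1"

lemma quat_units:
  "quat_i * quat_i = (-1 :: 'a::comm_ring_1 quat)"
  "quat_j * quat_j = (-1 :: 'a quat)"
  "quat_k * quat_k = (-1 :: 'a quat)"
  "quat_i * quat_j * quat_k = (-1 :: 'a quat)"
  by (simp_all add: quat_i_def quat_j_def quat_k_def times_quat_def uminus_quat_def one_quat_def)

definition quat_of :: "'a::comm_ring_1 \<Rightarrow> 'a quat" where
  "quat_of c = Quat c 0 0 0"

definition quat_conj :: "'a::comm_ring_1 quat \<Rightarrow> 'a quat" where
  "quat_conj h = Quat (q1 h) (- q2 h) (- q3 h) (- q4 h)"

definition quat_scale :: "'a::comm_ring_1 \<Rightarrow> 'a quat \<Rightarrow> 'a quat" where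
  "quat_scale c h = Quat (c * q1 h) (c * q2 h) (c * q3 h) (c * q4 h)"

lemma quat_scale_eq:
  "quat_scale c h = quat_of c * h" "quat_scale c h = h * quat_of c"
  by (simp_all add: quat_scale_def quat_of_def times_quat_def mult.commute)

global_interpretation cquat: vector_space "quat_scale :: complex \<Rightarrow> complex quat \<Rightarrow> complex quat"
  by standard (simp_all add: quat_scale_def plus_quat_def algebra_simps)


section \<open>Polynomials in two central variables\<close>

text \<open>
  The coefficient of $s^i t^j$ is \<open>Poly_Mapping.lookup Q (i, j)\<close>. Multiplication of
  \<open>poly_mapping\<close> is convolution, which makes the variables commute with each other and with
  the (possibly non-commuting) coefficients.
\<close>

type_synonym 'a bipoly = "(nat \<times> nat) \<Rightarrow>\<^sub>0 'a"

definition deg_s :: "'a::zero bipoly \<Rightarrow> nat" where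
  "deg_s Q = Max (insert 0 (fst ` Poly_Mapping.keys Q))"

definition deg_t :: "'a::zero bipoly \<Rightarrow> nat" where
  "deg_t Q = Max (insert 0 (snd ` Poly_Mapping.keys Q))"

definition bidegree :: "'a::zero bipoly \<Rightarrow> nat \<times> nat" where
  "bidegree Q = (deg_s Q, deg_t Q)"

definition polys_in_s :: "'a::zero bipoly set" where
  "polys_in_s = {Q. \<forall>(i, j) \<in> Poly_Mapping.keys Q. j = 0}"

definition polys_in_t :: "'a::zero bipoly set" where
  "polys_in_t = {Q. \<forall>(i, j) \<in> Poly_Mapping.keys Q. i = 0}"

definition scalar_bipoly :: "'a::comm_ring_1 bipoly \<Rightarrow> 'a quat bipoly" where
  "scalar_bipoly P = Poly_Mapping.map quat_of P"

definition conj_bipoly :: "'a::comm_ring_1 quat bipoly \<Rightarrow> 'a quat bipoly" where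
  "conj_bipoly Q = Poly_Mapping.map quat_conj Q"

definition complexify :: "real quat bipoly \<Rightarrow> complex quat bipoly" where
  "complexify Q = Poly_Mapping.map (map_quat complex_of_real) Q"

definition eval_at :: "complex quat bipoly \<Rightarrow> complex \<Rightarrow> complex \<Rightarrow> complex quat" where
  "eval_at Q s t = (\<Sum>(i, j) \<in> Poly_Mapping.keys Q. quat_scale (s ^ i * t ^ j) (Poly_Mapping.lookup Q (i, j)))"

definition primitive :: "complex quat bipoly \<Rightarrow> bool" where
  "primitive Q \<longleftrightarrow>
     \<not> (\<exists>(P :: complex bipoly) Q'. bidegree P \<noteq> (0, 0) \<and> Q = scalar_bipoly P * Q')"


section \<open>The projective space of the complex quaternions\<close>

text \<open>A point of the projective space is a one-dimensional complex subspace.\<close>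

definition proj_point :: "complex quat \<Rightarrow> complex quat set" where
  "proj_point x = range (\<lambda>c. quat_scale c x)"

definition projectivization :: "complex quat set \<Rightarrow> complex quat set set" where
  "projectivization V = proj_point ` (V - {0})"

definition P3 :: "complex quat set set" where
  "P3 = projectivization UNIV"

text \<open>
  A polynomial in the four homogeneous coordinates: its exponents are quadruples of natural numbers.
\<close>

type_synonym form4 = "(nat \<times> nat \<times> nat \<times> nat) \<Rightarrow>\<^sub>0 complex"

definition homogeneous :: "form4 \<Rightarrow> bool" where
  "homogeneous F \<longleftrightarrow> (\<exists>d. \<forall>(a, b, c, e) \<in> Poly_Mapping.keys F. a + b + c + e = d)"

definition form_value :: "form4 \<Rightarrow> complex quat \<Rightarrow> complex" where
  "form_value F x =
     (\<Sum>(a, b, c, e) \<in> Poly_Mapping.keys F. Poly_Mapping.lookup F (a, b, c, e) * q1 x ^ a * q2 x ^ b * q3 x ^ c * q4 x ^ e)"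

definition zero_locus :: "form4 set \<Rightarrow> complex quat set set" where
  "zero_locus \<F> = {z \<in> P3. \<forall>F \<in> \<F>. \<forall>x \<in> z. form_value F x = 0}"

definition zariski_closed :: "complex quat set set \<Rightarrow> bool" where
  "zariski_closed Z \<longleftrightarrow> (\<exists>\<F>. (\<forall>F \<in> \<F>. homogeneous F) \<and> Z = zero_locus \<F>)"

text \<open>
  For the set \<open>V\<close> of all values of a polynomial $R$ at complex arguments,
  \<open>value_closure V\<close> is the variety $[R]$.
\<close>

definition value_closure :: "complex quat set \<Rightarrow> complex quat set set" where
  "value_closure V = zariski_closed hull projectivization V"

definition null_quadric :: "complex quat set set" where
  "null_quadric = projectivization {x. (q1 x)\<^sup>2 + (q2 x)\<^sup>2 + (q3 x)\<^sup>2 + (q4 x)\<^sup>2 = 0}"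

lemma null_quadric_eq: "null_quadric = projectivization {h. h * quat_conj h = 0}"
  by (simp add: null_quadric_def times_quat_def quat_conj_def zero_quat_def power2_eq_square
      algebra_simps)

definition proj_line :: "complex quat set set \<Rightarrow> bool" where
  "proj_line L \<longleftrightarrow> (\<exists>W. cquat.subspace W \<and> cquat.dim W = 2 \<and> L = projectivization W)"

end

theory Submission
  imports Defs
begin

text \<open>
  Write $Q = a + b s + c t + d s t$. Since lines and the null quadric are closed, (i) only says that the real polynomial $Q Q^*$
  vanishes identically at $t = p$ and at $s = q$; non-real roots come in conjugate pairs, so
  $Q Q^*$ is divisible by a quadratic factor in $t$ and one in $s$.
  If $Q Q^* = A B$, then $d$ is invertible and one may take $d = 1$. Comparing coefficients
  gives the inner products of $a$ with $1, b, c$ and the norm of $a$; the products $b c$ and $c b$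
  share these data and are mirror images of each other with respect to the span of $1, b, c$,
  hence $a$ is one of them and $Q$ factors.
  Finally, the norm of a linear factor of $Q$ has a non-real root unless the factor is
  a constant times a real linear polynomial, which primitivity excludes.
\<close>

section \<open>The quaternion inner product and the factorization with leading coefficient 1\<close>

text \<open>Bilinear over every coefficient ring, without complex conjugation: over the reals it is
  the Euclidean inner product, while over the complex numbers \<open>qdot x x = 0\<close> is the
  equation of the null quadric.\<close>

definition qdot :: "'a::comm_ring_1 quat \<Rightarrow> 'a quat \<Rightarrow> 'a" where
  "qdot x y = q1 x * q1 y + q2 x * q2 y + q3 x * q3 y + q4 x * q4 y"

lemma qdot_self_eq_0_iff: "qdot x x = 0 \<longleftrightarrow> x = 0" for x :: "real quat"
proof
  assume "qdot x x = 0"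
  then have "(q1 x)\<^sup>2 + (q2 x)\<^sup>2 + (q3 x)\<^sup>2 + (q4 x)\<^sup>2 = 0"
    by (simp add: qdot_def power2_eq_square)
  then have "(q1 x)\<^sup>2 = 0 \<and> (q2 x)\<^sup>2 = 0 \<and> (q3 x)\<^sup>2 = 0 \<and> (q4 x)\<^sup>2 = 0"
    using zero_le_power2[of "q1 x"] zero_le_power2[of "q2 x"] zero_le_power2[of "q3 x"]
      zero_le_power2[of "q4 x"] by linarith
  then show "x = 0"
    by (simp add: zero_quat_def quat.expand)
qed (simp add: qdot_def zero_quat_def)

lemma qdot_self_nonneg: "qdot x x \<ge> 0" for x :: "real quat"
  by (simp add: qdot_def)

text \<open>Polarized multiplicativity of the norm. It transports the norm equations of $Q$ to those
  of $Q d^{-1}$, which has leading coefficient 1.\<close>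

lemma qdot_mult_right: "qdot (x * d) (y * d) = qdot x y * qdot d d"
  by (simp add: qdot_def times_quat_def algebra_simps)

lemma qdot_commute: "qdot x y = qdot y x"
  by (simp add: qdot_def mult.commute)

lemma real_quat_right_divide:
  fixes d x :: "real quat"
  assumes "d \<noteq> 0"
  obtains y where "x = y * d"
proof
  have "qdot d d \<noteq> 0" using assms qdot_self_eq_0_iff by blast
  then show "x = quat_scale (1 / qdot d d) (x * quat_conj d) * d"
    by (intro quat.expand, simp add: quat_scale_def quat_conj_def times_quat_def field_simps)
      (simp add: qdot_def algebra_simps)
qed

text \<open>In real 3-space a vector orthogonal to $b$ and $c$ is parallel to their cross product
  $w$; equal length then leaves only the sign. If $w = 0$, equality of lengths forces the vector to
  vanish as well.\<close>

lemma parallel_to_cross: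
  fixes e1 :: real
  assumes "e1 * b1 + e2 * b2 + e3 * b3 = 0" "e1 * c1 + e2 * c2 + e3 * c3 = 0"
    and w: "w1 = b2 * c3 - b3 * c2" "w2 = b3 * c1 - b1 * c3" "w3 = b1 * c2 - b2 * c1"
    and n: "e1\<^sup>2 + e2\<^sup>2 + e3\<^sup>2 = w1\<^sup>2 + w2\<^sup>2 + w3\<^sup>2"
  shows "(e1 = w1 \<and> e2 = w2 \<and> e3 = w3) \<or> (e1 = - w1 \<and> e2 = - w2 \<and> e3 = - w3)"
proof -
  have c: "e2 * w3 = e3 * w2" "e3 * w1 = e1 * w3" "e1 * w2 = e2 * w1"
    using assms(1,2) unfolding w by algebra+
  define m where "m = w1\<^sup>2 + w2\<^sup>2 + w3\<^sup>2"
  define k where "k = e1 * w1 + e2 * w2 + e3 * w3"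
  have "m * e1 = k * w1" "m * e2 = k * w2" "m * e3 = k * w3"
    using c unfolding m_def k_def by algebra+
  \<comment> \<open>Lagrange's identity for the parallel vectors $e$ and $w$ of equal
    length.\<close>
  moreover have "k\<^sup>2 = m\<^sup>2"
    using c n unfolding m_def k_def by algebra
  then have "k = m \<or> k = - m"
    by (simp add: power2_eq_iff)
  moreover have "e1 = 0 \<and> e2 = 0 \<and> e3 = 0 \<and> w1 = 0 \<and> w2 = 0 \<and> w3 = 0" if "m = 0"
  proof -
    have "w1\<^sup>2 = 0 \<and> w2\<^sup>2 = 0 \<and> w3\<^sup>2 = 0 \<and> e1\<^sup>2 = 0 \<and> e2\<^sup>2 = 0 \<and> e3\<^sup>2 = 0"
      using that n zero_le_power2[of w1] zero_le_power2[of w2] zero_le_power2[of w3]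
       zero_le_power2[of e1] zero_le_power2[of e2] zero_le_power2[of e3] unfolding m_def by linarith
    then show ?thesis by simp
  qed
  ultimately show ?thesis
    by (metis mult_cancel_left mult_minus_left mult_minus_right)
qed

text \<open>The hypotheses compare the coefficients of $st$, $s$, $t$ and 1 in the norm of $a + b s
  + c t + s t$ with those of a product; the conclusions are the constant terms of $(s + c)(t + b)$
  and $(t + b)(s + c)$.\<close>

lemma monic_factor:
  fixes a b c :: "real quat"
  assumes "qdot a 1 + qdot b c = 2 * qdot b 1 * qdot c 1"
    and "qdot a b = qdot b b * qdot c 1"
    and "qdot a c = qdot c c * qdot b 1"
    and "qdot a a = qdot b b * qdot c c"
  shows "a = c * b \<or> a = b * c"
proof -
  obtain a1 a2 a3 a4 where a: "a = Quat a1 a2 a3 a4" by (cases a)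
  obtain b1 b2 b3 b4 where b: "b = Quat b1 b2 b3 b4" by (cases b)
  obtain c1 c2 c3 c4 where c: "c = Quat c1 c2 c3 c4" by (cases c)
  note as = assms[unfolded a b c qdot_def one_quat_def, simplified]
  txt \<open>
    Subtracting the common part \<open>(b * c + c * b) / 2\<close> leaves an imaginary remainder orthogonal to
    \<open>b\<close> and \<open>c\<close> whose norm is that of \<open>(b * c - c * b) / 2\<close>, the cross product of the imaginary parts.
  \<close>
  define e2 e3 e4 where e: "e2 = a2 - b1 * c2 - b2 * c1" "e3 = a3 - b1 * c3 - b3 * c1"
    "e4 = a4 - b1 * c4 - b4 * c1"
  \<comment> \<open>The first hypothesis fixes the real part of \<open>a\<close>: it is the common
    real part of \<open>b * c\<close> and \<open>c * b\<close>.\<close>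
  have a1: "a1 = b1 * c1 - b2 * c2 - b3 * c3 - b4 * c4"
    using as(1) by (simp add: algebra_simps)
  have a234: "a2 = e2 + b1 * c2 + b2 * c1" "a3 = e3 + b1 * c3 + b3 * c1" "a4 = e4 + b1 * c4 + b4 * c1"
    by (simp_all add: e)
  have eb: "e2 * b2 + e3 * b3 + e4 * b4 = 0"
    using as(2) unfolding a1 a234 by (simp add: algebra_simps)
  have ec: "e2 * c2 + e3 * c3 + e4 * c4 = 0"
    using as(3) unfolding a1 a234 by (simp add: algebra_simps)
  have "e2\<^sup>2 + e3\<^sup>2 + e4\<^sup>2 = (b3 * c4 - b4 * c3)\<^sup>2 + (b4 * c2 - b2 * c4)\<^sup>2 + (b2 * c3 - b3 * c2)\<^sup>2"
    using as(4) eb ec unfolding a1 a234 by algebra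
  \<comment> \<open>The plus sign yields \<open>b * c\<close>, the minus sign
    \<open>c * b\<close>.\<close>
  from parallel_to_cross[OF eb ec refl refl refl this] show ?thesis
    by (auto simp: a b c times_quat_def a1 a234)
qed

section \<open>Polynomials in two variables\<close>

text \<open>\<open>Poly_Mapping.map\<close> applies \<open>f\<close> to the non-zero coefficients
  only, hence the condition \<open>f 0 = 0\<close>.\<close>

lemma lookup_poly_mapping_map: "f 0 = 0 \<Longrightarrow> Poly_Mapping.lookup (Poly_Mapping.map f p) k = f (Poly_Mapping.lookup p k)"
  by (simp add: Poly_Mapping.map.rep_eq when_def)

lemma poly_mapping_map_add:
  assumes "f 0 = 0" "\<And>x y. f (x + y) = f x + f y"
  shows "Poly_Mapping.map f (p + q) = Poly_Mapping.map f p + Poly_Mapping.map f q"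
  by (rule poly_mapping_eqI) (simp add: assms lookup_poly_mapping_map lookup_add)

lemma scalar_bipoly_add: "scalar_bipoly (P + R) = scalar_bipoly P + scalar_bipoly R"
  unfolding scalar_bipoly_def by (rule poly_mapping_map_add) (simp_all add: quat_of_def zero_quat_def plus_quat_def)

lemma scalar_bipoly_single: "scalar_bipoly (Poly_Mapping.single k c) = Poly_Mapping.single k (quat_of c)"
  unfolding scalar_bipoly_def by (rule map_single) (simp_all add: quat_of_def zero_quat_def)

lemma conj_bipoly_add: "conj_bipoly (P + R) = conj_bipoly P + conj_bipoly R"
  unfolding conj_bipoly_def by (rule poly_mapping_map_add) (simp_all add: quat_conj_def zero_quat_def plus_quat_def)

lemma conj_bipoly_single: "conj_bipoly (Poly_Mapping.single k c) = Poly_Mapping.single k (quat_conj c)"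
  unfolding conj_bipoly_def by (rule map_single) (simp_all add: quat_conj_def zero_quat_def)

lemma complexify_add: "complexify (P + R) = complexify P + complexify R"
  unfolding complexify_def by (rule poly_mapping_map_add) (simp_all add: zero_quat_def plus_quat_def quat.map_sel)

lemma complexify_single:
  "complexify (Poly_Mapping.single k c) = Poly_Mapping.single k (map_quat complex_of_real c)"
  unfolding complexify_def by (rule map_single) (simp_all add: zero_quat_def)

text \<open>Summing over a common finite set of exponents makes values of different polynomials
  comparable; this gives additivity.\<close>

lemma eval_at_superset:
  assumes "finite K" "Poly_Mapping.keys Q \<subseteq> K"
  shows "eval_at Q s t = (\<Sum>(i, j) \<in> K. quat_scale (s ^ i * t ^ j) (Poly_Mapping.lookup Q (i, j)))"
  unfolding eval_at_def using assms
  by (intro sum.mono_neutral_left) (auto simp: in_keys_iff)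

lemma eval_at_add: "eval_at (P + R) s t = eval_at P s t + eval_at R s t"
proof -
  let ?K = "Poly_Mapping.keys P \<union> Poly_Mapping.keys R"
  have "finite ?K" "Poly_Mapping.keys (P + R) \<subseteq> ?K" "Poly_Mapping.keys P \<subseteq> ?K" "Poly_Mapping.keys R \<subseteq> ?K"
    using keys_add[of P R] by auto
  then show ?thesis
    by (simp add: eval_at_superset[of ?K] lookup_add cquat.scale_right_distrib case_prod_unfold sum.distrib)
qed

lemma eval_at_single: "eval_at (Poly_Mapping.single (i, j) c) s t = quat_scale (s ^ i * t ^ j) c"
  by (subst eval_at_superset[of "{(i, j)}"]) simp_all

text \<open>The side condition records that $s$ really occurs; it later keeps the leading
  coefficient of the norm from vanishing.\<close>

lemma bidegree_1_1E:
  fixes Q :: "'a::comm_monoid_add bipoly"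
  assumes "bidegree Q = (1, 1)"
  obtains a b c d where "Q = Poly_Mapping.single (0, 0) a + Poly_Mapping.single (1, 0) b
      + Poly_Mapping.single (0, 1) c + Poly_Mapping.single (1, 1) d"
    and "b \<noteq> 0 \<or> d \<noteq> 0"
proof
  let ?f = "\<lambda>i j. Poly_Mapping.lookup Q (i, j)"
  have m: "Max (insert 0 (fst ` Poly_Mapping.keys Q)) = 1" "Max (insert 0 (snd ` Poly_Mapping.keys Q)) = 1"
    using assms by (auto simp: bidegree_def deg_s_def deg_t_def)
  have le: "i \<le> 1 \<and> j \<le> 1" if "?f i j \<noteq> 0" for i j
  proof -
    have "(i, j) \<in> Poly_Mapping.keys Q" using that by (simp add: in_keys_iff)
    then have "i \<in> insert 0 (fst ` Poly_Mapping.keys Q)" "j \<in> insert 0 (snd ` Poly_Mapping.keys Q)"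
      by force+
    then show ?thesis
      using m Max_ge[of "insert 0 (fst ` Poly_Mapping.keys Q)" i] Max_ge[of "insert 0 (snd ` Poly_Mapping.keys Q)" j]
      by auto
  qed
  show "Q = Poly_Mapping.single (0, 0) (?f 0 0) + Poly_Mapping.single (1, 0) (?f 1 0)
      + Poly_Mapping.single (0, 1) (?f 0 1) + Poly_Mapping.single (1, 1) (?f 1 1)" (is "Q = ?R")
  proof (rule poly_mapping_eqI)
    fix k :: "nat \<times> nat"
    obtain i j where k: "k = (i, j)" by force
    consider "i = 0" "j = 0" | "i = 1" "j = 0" | "i = 0" "j = 1" | "i = 1" "j = 1" | "\<not> (i \<le> 1 \<and> j \<le> 1)"
      by linarith
    then show "Poly_Mapping.lookup Q k = Poly_Mapping.lookup ?R k"
      using le[of i j] by cases (auto simp: k lookup_add lookup_single when_def)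
  qed
  have "1 \<in> insert 0 (fst ` Poly_Mapping.keys Q)"
    using Max_in[of "insert 0 (fst ` Poly_Mapping.keys Q)"] m by auto
  then obtain j where "(1, j) \<in> Poly_Mapping.keys Q" by force
  then have "?f 1 j \<noteq> 0" by (simp add: in_keys_iff)
  with le[of 1 j] show "?f 1 0 \<noteq> 0 \<or> ?f 1 1 \<noteq> 0"
    by (metis le_neq_implies_less less_one)
qed

lemma lookup_sum_single_s:
  "Poly_Mapping.lookup (\<Sum>i\<le>n. Poly_Mapping.single (i::nat, 0::nat) (f i)) (k, l) = (if k \<le> n \<and> l = 0 then f k else 0)"
  by (cases "l = 0") (simp_all add: lookup_sum lookup_single when_def)

lemma lookup_sum_single_t:
  "Poly_Mapping.lookup (\<Sum>i\<le>n. Poly_Mapping.single (0::nat, i::nat) (f i)) (k, l) = (if k = 0 \<and> l \<le> n then f l else 0)"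
  by (cases "k = 0") (simp_all add: lookup_sum lookup_single when_def)

text \<open>The guard \<open>n > 0\<close> is there because the zero polynomial also has degree
  0.\<close>

lemma polys_in_s_degE:
  fixes S :: "'a::comm_monoid_add bipoly"
  assumes "S \<in> polys_in_s" "deg_s S = n"
  obtains f where "S = (\<Sum>i\<le>n. Poly_Mapping.single (i, 0) (f i))" "n > 0 \<Longrightarrow> f n \<noteq> 0"
proof
  let ?f = "\<lambda>i. Poly_Mapping.lookup S (i, 0)" and ?D = "insert 0 (fst ` Poly_Mapping.keys S)"
  have le: "i \<le> n \<and> j = 0" if "Poly_Mapping.lookup S (i, j) \<noteq> 0" for i j
  proof -
    have k: "(i, j) \<in> Poly_Mapping.keys S" using that by (simp add: in_keys_iff)
    then have "i \<in> ?D" by force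
    then show ?thesis
      using k assms Max_ge[of ?D i] by (auto simp: deg_s_def polys_in_s_def)
  qed
  show "S = (\<Sum>i\<le>n. Poly_Mapping.single (i, 0) (?f i))"
  proof (rule poly_mapping_eqI)
    fix k :: "nat \<times> nat"
    obtain i j where k: "k = (i, j)" by force
    show "Poly_Mapping.lookup S k = Poly_Mapping.lookup (\<Sum>i\<le>n. Poly_Mapping.single (i, 0) (?f i)) k"
      using le[of i j] by (auto simp: k lookup_sum_single_s)
  qed
  assume "n > 0"
  moreover have "n \<in> ?D"
    using Max_in[of ?D] assms by (auto simp: deg_s_def)
  ultimately obtain j where "(n, j) \<in> Poly_Mapping.keys S" by force
  then show "?f n \<noteq> 0" using le[of n j] by (auto simp: in_keys_iff)
qed

lemma polys_in_t_degE:
  fixes S :: "'a::comm_monoid_add bipoly"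
  assumes "S \<in> polys_in_t" "deg_t S = n"
  obtains f where "S = (\<Sum>i\<le>n. Poly_Mapping.single (0, i) (f i))" "n > 0 \<Longrightarrow> f n \<noteq> 0"
proof
  let ?f = "\<lambda>i. Poly_Mapping.lookup S (0, i)" and ?D = "insert 0 (snd ` Poly_Mapping.keys S)"
  have le: "i \<le> n \<and> j = 0" if "Poly_Mapping.lookup S (j, i) \<noteq> 0" for i j
  proof -
    have k: "(j, i) \<in> Poly_Mapping.keys S" using that by (simp add: in_keys_iff)
    then have "i \<in> ?D" by force
    then show ?thesis
      using k assms Max_ge[of ?D i] by (auto simp: deg_t_def polys_in_t_def)
  qed
  show "S = (\<Sum>i\<le>n. Poly_Mapping.single (0, i) (?f i))"
  proof (rule poly_mapping_eqI)
    fix k :: "nat \<times> nat"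
    obtain i j where k: "k = (j, i)" by force
    show "Poly_Mapping.lookup S k = Poly_Mapping.lookup (\<Sum>i\<le>n. Poly_Mapping.single (0, i) (?f i)) k"
      using le[of j i] by (auto simp: k lookup_sum_single_t)
  qed
  assume "n > 0"
  moreover have "n \<in> ?D"
    using Max_in[of ?D] assms by (auto simp: deg_t_def)
  ultimately obtain j where "(j, n) \<in> Poly_Mapping.keys S" by force
  then show "?f n \<noteq> 0" using le[of j n] by (auto simp: in_keys_iff)
qed

lemma keys_sum_s:
  "Poly_Mapping.keys (\<Sum>i\<le>n. Poly_Mapping.single (i::nat, 0::nat) (f i)) = (\<lambda>i. (i, 0)) ` {i. i \<le> n \<and> f i \<noteq> 0}"
  by (auto simp: in_keys_iff lookup_sum_single_s split: if_splits)

lemma keys_sum_t: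
  "Poly_Mapping.keys (\<Sum>i\<le>n. Poly_Mapping.single (0::nat, i::nat) (f i)) = (\<lambda>i. (0, i)) ` {i. i \<le> n \<and> f i \<noteq> 0}"
  by (auto simp: in_keys_iff lookup_sum_single_t split: if_splits)

lemma sum_in_polys_in_s: "(\<Sum>i\<le>n. Poly_Mapping.single (i, 0) (f i)) \<in> polys_in_s"
  unfolding polys_in_s_def by (auto simp: keys_sum_s)

lemma sum_in_polys_in_t: "(\<Sum>i\<le>n. Poly_Mapping.single (0, i) (f i)) \<in> polys_in_t"
  unfolding polys_in_t_def by (auto simp: keys_sum_t)

lemma deg_s_sum: "f n \<noteq> 0 \<Longrightarrow> deg_s (\<Sum>i\<le>n. Poly_Mapping.single (i, 0) (f i)) = n"
  unfolding deg_s_def keys_sum_s by (rule Max_eqI) (auto simp: image_image)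

lemma deg_t_sum: "f n \<noteq> 0 \<Longrightarrow> deg_t (\<Sum>i\<le>n. Poly_Mapping.single (0, i) (f i)) = n"
  unfolding deg_t_def keys_sum_t by (rule Max_eqI) (auto simp: image_image)

section \<open>Zariski closed sets\<close>

lemma form_value_superset:
  assumes "finite K" "Poly_Mapping.keys F \<subseteq> K"
  shows "form_value F x = (\<Sum>(a, b, c, e) \<in> K. Poly_Mapping.lookup F (a, b, c, e) * q1 x ^ a * q2 x ^ b * q3 x ^ c * q4 x ^ e)"
  unfolding form_value_def using assms
  by (intro sum.mono_neutral_left) (auto simp: in_keys_iff)

lemma form_value_add: "form_value (F + G) x = form_value F x + form_value G x"
proof -
  let ?K = "Poly_Mapping.keys F \<union> Poly_Mapping.keys G"
  have "finite ?K" "Poly_Mapping.keys (F + G) \<subseteq> ?K" "Poly_Mapping.keys F \<subseteq> ?K" "Poly_Mapping.keys G \<subseteq> ?K"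
    using keys_add[of F G] by auto
  then show ?thesis
    by (simp add: form_value_superset[of ?K] lookup_add case_prod_unfold distrib_right sum.distrib)
qed

lemma form_value_single:
  "form_value (Poly_Mapping.single (a, b, c, e) k) x = k * q1 x ^ a * q2 x ^ b * q3 x ^ c * q4 x ^ e"
  by (subst form_value_superset[of "{(a, b, c, e)}"]) simp_all

text \<open>One family for both kinds of equations in use: \<open>n = 2\<close> with unit
  coefficients is the equation of the null quadric, \<open>n = 1\<close> gives all linear
  forms.\<close>

definition diagonal_form :: "nat \<Rightarrow> complex \<Rightarrow> complex \<Rightarrow> complex \<Rightarrow> complex \<Rightarrow> form4" where
  "diagonal_form n k1 k2 k3 k4 = Poly_Mapping.single (n, 0, 0, 0) k1 + Poly_Mapping.single (0, n, 0, 0) k2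
     + Poly_Mapping.single (0, 0, n, 0) k3 + Poly_Mapping.single (0, 0, 0, n) k4"

lemma homogeneous_diagonal_form: "homogeneous (diagonal_form n k1 k2 k3 k4)"
proof -
  have "Poly_Mapping.keys (diagonal_form n k1 k2 k3 k4) \<subseteq> {(n, 0, 0, 0), (0, n, 0, 0), (0, 0, n, 0), (0, 0, 0, n)}"
    unfolding diagonal_form_def
    by (intro order_trans[OF keys_add] Un_least order_trans[OF keys_single[THEN equalityD1]]) simp_all
  then show ?thesis unfolding homogeneous_def by (intro exI[of _ n]) auto
qed

lemma form_value_diagonal_form:
  "form_value (diagonal_form n k1 k2 k3 k4) x = k1 * q1 x ^ n + k2 * q2 x ^ n + k3 * q3 x ^ n + k4 * q4 x ^ n"
  by (simp add: diagonal_form_def form_value_add form_value_single)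

lemma mem_proj_point: "x \<in> proj_point x"
  unfolding proj_point_def by (metis cquat.scale_one rangeI)

lemma zariski_closed_null_quadric: "zariski_closed null_quadric"
proof -
  have "null_quadric = zero_locus {diagonal_form 2 1 1 1 1}"
  proof (intro equalityI subsetI)
    fix z assume "z \<in> null_quadric"
    then obtain x where x: "x \<noteq> 0" "z = proj_point x" "(q1 x)\<^sup>2 + (q2 x)\<^sup>2 + (q3 x)\<^sup>2 + (q4 x)\<^sup>2 = 0"
      by (auto simp: null_quadric_def projectivization_def)
    \<comment> \<open>\<open>zero_locus\<close> asks for vanishing at every representative of a
      point, so homogeneity enters here.\<close>
    have "(c * q1 x)\<^sup>2 + (c * q2 x)\<^sup>2 + (c * q3 x)\<^sup>2 + (c * q4 x)\<^sup>2 = 0" for c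
    proof -
      have "(c * q1 x)\<^sup>2 + (c * q2 x)\<^sup>2 + (c * q3 x)\<^sup>2 + (c * q4 x)\<^sup>2
        = c\<^sup>2 * ((q1 x)\<^sup>2 + (q2 x)\<^sup>2 + (q3 x)\<^sup>2 + (q4 x)\<^sup>2)"
        by (simp add: power2_eq_square algebra_simps)
      then show ?thesis using x(3) by simp
    qed
    then show "z \<in> zero_locus {diagonal_form 2 1 1 1 1}"
      using x unfolding zero_locus_def P3_def projectivization_def
      by (simp add: form_value_diagonal_form) (simp add: proj_point_def quat_scale_def)
  next
    fix z assume "z \<in> zero_locus {diagonal_form 2 1 1 1 1}"
    then obtain x where x: "x \<noteq> 0" "z = proj_point x" and "\<forall>y \<in> z. form_value (diagonal_form 2 1 1 1 1) y = 0"
      by (auto simp: zero_locus_def P3_def projectivization_def)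
    then have "form_value (diagonal_form 2 1 1 1 1) x = 0"
      using mem_proj_point[of x] by blast
    with x(1) have "x \<in> {x. (q1 x)\<^sup>2 + (q2 x)\<^sup>2 + (q3 x)\<^sup>2 + (q4 x)\<^sup>2 = 0} - {0}"
      by (simp add: form_value_diagonal_form)
    with x(2) show "z \<in> null_quadric"
      unfolding projectivization_def null_quadric_def by blast
  qed
  then show ?thesis
    unfolding zariski_closed_def
    by (intro exI[of _ "{diagonal_form 2 1 1 1 1}"]) (simp add: homogeneous_diagonal_form)
qed

section \<open>Linear subspaces and lines\<close>

interpretation cquat_functional: vector_space_pair
  "quat_scale :: complex \<Rightarrow> complex quat \<Rightarrow> complex quat" "(*) :: complex \<Rightarrow> complex \<Rightarrow> complex"
  by unfold_locales (simp_all add: algebra_simps)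

text \<open>Adjoin \<open>x\<close> to a basis of \<open>W\<close> and take the linear functional
  that is 1 at \<open>x\<close> and 0 on the basis. Its values on the four quaternion units are the
  required coefficients.\<close>

lemma subspace_separating_functional:
  assumes "cquat.subspace W" "x \<notin> W"
  obtains k1 k2 k3 k4 where
    "\<And>y. y \<in> W \<Longrightarrow> k1 * q1 y + k2 * q2 y + k3 * q3 y + k4 * q4 y = 0"
    "k1 * q1 x + k2 * q2 x + k3 * q3 x + k4 * q4 x \<noteq> 0"
proof -
  obtain B where B: "B \<subseteq> W" "cquat.independent B" "cquat.span B = W"
    using cquat.maximal_independent_subset[of W] assms(1)
    by (metis cquat.span_eq_iff cquat.span_mono cquat.span_minimal subset_antisym)
  have "cquat.independent (insert x B)"
    using B assms(2) by (simp add: cquat.independent_insertI)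
  from cquat_functional.linear_independent_extend[OF this, of "\<lambda>y. if y = x then 1 else 0"]
  obtain g where g: "Vector_Spaces.linear quat_scale (*) g"
    and gB: "\<And>y. y \<in> insert x B \<Longrightarrow> g y = (if y = x then 1 else 0)"
    by blast
  interpret g: Vector_Spaces.linear quat_scale "(*) :: complex \<Rightarrow> complex \<Rightarrow> complex" g by (rule g)
  have eq: "g y = g 1 * q1 y + g quat_i * q2 y + g quat_j * q3 y + g quat_k * q4 y" for y
  proof -
    have "y = quat_scale (q1 y) 1 + quat_scale (q2 y) quat_i + quat_scale (q3 y) quat_j + quat_scale (q4 y) quat_k"
      by (simp add: quat_scale_def one_quat_def quat_i_def quat_j_def quat_k_def plus_quat_def)
    then have "g y = g (quat_scale (q1 y) 1 + quat_scale (q2 y) quat_i + quat_scale (q3 y) quat_j + quat_scale (q4 y) quat_k)"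
      by simp
    then show ?thesis by (simp add: g.add g.scale mult.commute)
  qed
  have "g y = 0" if "y \<in> W" for y
  proof -
    have "y \<in> cquat.span B" using that B by simp
    then show ?thesis
      by (rule g.eq_0_on_span[rotated]) (use gB B assms(2) in auto)
  qed
  with gB[of x] show ?thesis using that[of "g 1" "g quat_i" "g quat_j" "g quat_k"] by (simp flip: eq)
qed

lemma zariski_closed_projectivization_subspace:
  assumes W: "cquat.subspace W"
  shows "zariski_closed (projectivization W)"
proof -
  \<comment> \<open>The whole homogeneous vanishing ideal of \<open>W\<close>; its linear members
    already separate \<open>W\<close> from every other point.\<close>
  let ?F = "{F. homogeneous F \<and> (\<forall>x \<in> W. form_value F x = 0)}"
  have "projectivization W = zero_locus ?F"
  proof (intro equalityI subsetI)
    fix z assume "z \<in> projectivization W"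
    then obtain x where x: "x \<in> W" "x \<noteq> 0" "z = proj_point x"
      by (auto simp: projectivization_def)
    have "z \<subseteq> W"
      using cquat.subspace_scale[OF W x(1)] by (auto simp: x(3) proj_point_def)
    then show "z \<in> zero_locus ?F"
      using x by (auto simp: zero_locus_def P3_def projectivization_def)
  next
    fix z assume z: "z \<in> zero_locus ?F"
    then obtain x where x: "x \<noteq> 0" "z = proj_point x"
      by (auto simp: zero_locus_def P3_def projectivization_def)
    have "x \<in> W"
    proof (rule ccontr)
      assume "x \<notin> W"
      then obtain k1 k2 k3 k4 where k:
        "\<And>y. y \<in> W \<Longrightarrow> k1 * q1 y + k2 * q2 y + k3 * q3 y + k4 * q4 y = 0"
        "k1 * q1 x + k2 * q2 x + k3 * q3 x + k4 * q4 x \<noteq> 0"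
        using subspace_separating_functional[OF W] by metis
      then have "diagonal_form 1 k1 k2 k3 k4 \<in> ?F"
        by (simp add: homogeneous_diagonal_form form_value_diagonal_form)
      with z x have "form_value (diagonal_form 1 k1 k2 k3 k4) x = 0"
        using mem_proj_point[of x] unfolding zero_locus_def by blast
      with k(2) show False by (simp add: form_value_diagonal_form)
    qed
    with x show "z \<in> projectivization W" by (auto simp: projectivization_def)
  qed
  then show ?thesis unfolding zariski_closed_def by (intro exI[of _ ?F]) simp
qed

text \<open>If \<open>u\<close> and \<open>v\<close> are dependent, their span is too small. Both
  then lie on the span of one non-zero vector, which is enlarged by any vector outside it.\<close>

lemma exists_plane:
  obtains W where "cquat.subspace W" "cquat.dim W = 2" "u \<in> W" "v \<in> W"
proof -
  have "\<exists>x y. x \<noteq> y \<and> cquat.independent {x, y} \<and> u \<in> cquat.span {x, y} \<and> v \<in> cquat.span {x, y}"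
  proof (cases "u \<noteq> v \<and> cquat.independent {u, v}")
    case True
    then show ?thesis
      by (meson cquat.span_base insertI1 insertI2)
  next
    case False
    obtain x where x: "x \<noteq> 0" "u \<in> cquat.span {x}" "v \<in> cquat.span {x}"
    proof (cases "u = 0")
      case True
      show ?thesis
      proof (cases "v = 0")
        case v: True
        have "(1 :: complex quat) \<noteq> 0" by (simp add: one_quat_def zero_quat_def)
        with True v that show ?thesis using cquat.span_zero by blast
      next
        case v: False
        show ?thesis using that[of v] True v by (simp add: cquat.span_zero cquat.span_base)
      qed
    next
      case u: False
      have "v \<in> cquat.span {u}"
      proof (rule ccontr)
        assume v: "v \<notin> cquat.span {u}"
        then have "cquat.independent {v, u}"
          using u cquat.independent_empty by (intro cquat.independent_insertI) auto
        moreover have "u \<noteq> v" using v cquat.span_base by blast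
        ultimately show False using False by (simp add: insert_commute)
      qed
      with u that show ?thesis by (simp add: cquat.span_base)
    qed
    \<comment> \<open>A one-dimensional span cannot contain both 1 and
      \<open>quat_i\<close>.\<close>
    have "\<exists>y. y \<notin> cquat.span {x}"
    proof (rule ccontr)
      assume "\<not> ?thesis"
      then have "1 \<in> range (\<lambda>c. quat_scale c x)" "quat_i \<in> range (\<lambda>c. quat_scale c x)"
        by (simp_all flip: cquat.span_singleton)
      then obtain c c' where "quat_scale c x = 1" "quat_scale c' x = quat_i"
        by (metis rangeE)
      then have "c * q1 x = 1" "c * q2 x = 0" "c' * q1 x = 0" "c' * q2 x = 1"
        by (simp_all add: one_quat_def quat_i_def quat_scale_def)
      then show False by (metis mult_eq_0_iff zero_neq_one)
    qed
    then obtain y where y: "y \<notin> cquat.span {x}" by blast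
    then have "cquat.independent {y, x}"
      using x(1) cquat.independent_empty by (intro cquat.independent_insertI) auto
    moreover have "y \<noteq> x" using y cquat.span_base by blast
    moreover have "cquat.span {x} \<subseteq> cquat.span {y, x}" by (intro cquat.span_mono) auto
    ultimately have "y \<noteq> x \<and> cquat.independent {y, x} \<and> u \<in> cquat.span {y, x} \<and> v \<in> cquat.span {y, x}"
      using x(2,3) by (simp add: subset_iff)
    then show ?thesis by (intro exI)
  qed
  then obtain x y where xy: "x \<noteq> y" "cquat.independent {x, y}" "u \<in> cquat.span {x, y}" "v \<in> cquat.span {x, y}"
    by blast
  show ?thesis
    by (rule that[of "cquat.span {x, y}"])
      (use xy in \<open>simp_all add: cquat.subspace_span cquat.dim_eq_card_independent\<close>)
qed

section \<open>Closures of value sets\<close>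

text \<open>As the null quadric is closed, taking the closure adds nothing to the condition. The
  value 0 defines no point but satisfies the equation, so it needs no exception on the
  right.\<close>

lemma value_closure_subset_iff_null:
  "value_closure V \<subseteq> null_quadric \<longleftrightarrow> (\<forall>x \<in> V. qdot x x = 0)"
proof
  assume *: "value_closure V \<subseteq> null_quadric"
  show "\<forall>x \<in> V. qdot x x = 0"
  proof
    fix x assume "x \<in> V"
    show "qdot x x = 0"
    proof (cases "x = 0")
      case False
      then have "proj_point x \<in> null_quadric"
        using * \<open>x \<in> V\<close> hull_subset[of "projectivization V" zariski_closed]
        by (auto simp: value_closure_def projectivization_def)
      then obtain y where y: "proj_point x = proj_point y" "(q1 y)\<^sup>2 + (q2 y)\<^sup>2 + (q3 y)\<^sup>2 + (q4 y)\<^sup>2 = 0"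
        by (auto simp: null_quadric_def projectivization_def)
      then obtain c where "x = quat_scale c y"
        using mem_proj_point[of x] by (auto simp: proj_point_def)
      then have "qdot x x = c\<^sup>2 * ((q1 y)\<^sup>2 + (q2 y)\<^sup>2 + (q3 y)\<^sup>2 + (q4 y)\<^sup>2)"
        by (simp add: qdot_def quat_scale_def power2_eq_square algebra_simps)
      with y show ?thesis by simp
    qed (simp add: qdot_def zero_quat_def)
  qed
next
  assume "\<forall>x \<in> V. qdot x x = 0"
  then have "projectivization V \<subseteq> null_quadric"
    by (auto simp: projectivization_def null_quadric_def qdot_def power2_eq_square)
  then show "value_closure V \<subseteq> null_quadric"
    unfolding value_closure_def by (rule hull_minimal) (rule zariski_closed_null_quadric)
qed

text \<open>This makes the line conditions of (i) automatic: \<open>Q\<close> is affine in each variable.\<close>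

lemma value_closure_affine_line:
  "\<exists>L. proj_line L \<and> value_closure (range (\<lambda>s. u + quat_scale s v)) \<subseteq> L"
proof -
  obtain W where W: "cquat.subspace W" "cquat.dim W = 2" "u \<in> W" "v \<in> W"
    by (rule exists_plane)
  have "u + quat_scale s v \<in> W" for s
    by (intro cquat.subspace_add cquat.subspace_scale W)
  then have "projectivization (range (\<lambda>s. u + quat_scale s v)) \<subseteq> projectivization W"
    unfolding projectivization_def by (intro image_mono) blast
  then have "value_closure (range (\<lambda>s. u + quat_scale s v)) \<subseteq> projectivization W"
    unfolding value_closure_def by (rule hull_minimal) (rule zariski_closed_projectivization_subspace[OF W(1)])
  then show ?thesis unfolding proj_line_def using W(1,2) by blast
qed

section \<open>The norm of a polynomial of bidegree (1,1)\<close>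

definition bilinear_poly :: "'a::comm_monoid_add \<Rightarrow> 'a \<Rightarrow> 'a \<Rightarrow> 'a \<Rightarrow> 'a bipoly" where
  "bilinear_poly a b c d = Poly_Mapping.single (0, 0) a + Poly_Mapping.single (1, 0) b
     + Poly_Mapping.single (0, 1) c + Poly_Mapping.single (1, 1) d"

definition biquadratic_poly :: "(nat \<Rightarrow> nat \<Rightarrow> 'a::comm_monoid_add) \<Rightarrow> 'a bipoly" where
  "biquadratic_poly h = (\<Sum>i\<le>2. \<Sum>j\<le>2. Poly_Mapping.single (i, j) (h i j))"

text \<open>
  \<open>norm_coeff a b c d i j\<close> is the coefficient of $s^i t^j$ in $Q Q^*$ for
  $Q = a + b s + c t + d s t$; the arguments follow the order of \<open>bilinear_poly\<close>.
\<close>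

fun norm_coeff :: "'a::comm_ring_1 quat \<Rightarrow> 'a quat \<Rightarrow> 'a quat \<Rightarrow> 'a quat \<Rightarrow> nat \<Rightarrow> nat \<Rightarrow> 'a" where
  "norm_coeff a b c d 0 0 = qdot a a"
| "norm_coeff a b c d (Suc 0) 0 = 2 * qdot a b"
| "norm_coeff a b c d (Suc (Suc 0)) 0 = qdot b b"
| "norm_coeff a b c d 0 (Suc 0) = 2 * qdot a c"
| "norm_coeff a b c d (Suc 0) (Suc 0) = 2 * qdot a d + 2 * qdot b c"
| "norm_coeff a b c d (Suc (Suc 0)) (Suc 0) = 2 * qdot b d"
| "norm_coeff a b c d 0 (Suc (Suc 0)) = qdot c c"
| "norm_coeff a b c d (Suc 0) (Suc (Suc 0)) = 2 * qdot c d"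
| "norm_coeff a b c d (Suc (Suc 0)) (Suc (Suc 0)) = qdot d d"
| "norm_coeff a b c d _ _ = 0"

lemma lookup_biquadratic_poly:
  assumes "k \<le> 2" "l \<le> 2"
  shows "Poly_Mapping.lookup (biquadratic_poly h) (k, l) = h k l"
proof -
  have "Poly_Mapping.lookup (biquadratic_poly h) (k, l)
    = (\<Sum>i\<le>2. if i = k then (\<Sum>j\<le>2. if j = l then h i j else 0) else 0)"
    unfolding biquadratic_poly_def lookup_sum
    by (intro sum.cong refl) (auto simp: lookup_single when_def intro!: sum.cong)
  with assms show ?thesis by simp
qed

lemma scalar_bipoly_sum: "scalar_bipoly (sum f I) = (\<Sum>i\<in>I. scalar_bipoly (f i))"
  by (induction I rule: infinite_finite_induct)
    (simp_all add: scalar_bipoly_add, simp_all add: scalar_bipoly_def poly_mapping_eqI lookup_poly_mapping_map quat_of_def zero_quat_def)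

lemma quat_of_mult: "quat_of x * quat_of y = quat_of (x * y)"
  by (simp add: quat_of_def times_quat_def)

lemma quat_of_add: "quat_of (x + y) = quat_of x + quat_of y"
  by (simp add: quat_of_def plus_quat_def)

lemma quat_of_inject: "quat_of x = quat_of y \<longleftrightarrow> x = y"
  by (simp add: quat_of_def)

text \<open>A product of a polynomial in $s$ and one in $t$ has a coefficient matrix of rank at most
  one; condition (iii) is used in this form.\<close>

lemma scalar_bipoly_mult_univariate:
  "scalar_bipoly (\<Sum>i\<le>2. Poly_Mapping.single (i, 0) (f i)) * scalar_bipoly (\<Sum>j\<le>2. Poly_Mapping.single (0, j) (g j))
   = scalar_bipoly (biquadratic_poly (\<lambda>i j. f i * g j))"
  by (simp add: biquadratic_poly_def scalar_bipoly_sum scalar_bipoly_single sum_product mult_single quat_of_mult)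

lemma scalar_biquadratic_poly_eqD:
  assumes "scalar_bipoly (biquadratic_poly g) = scalar_bipoly (biquadratic_poly h)" "i \<le> 2" "j \<le> 2"
  shows "g i j = h i j"
proof -
  have "Poly_Mapping.lookup (scalar_bipoly (biquadratic_poly g)) (i, j)
    = Poly_Mapping.lookup (scalar_bipoly (biquadratic_poly h)) (i, j)"
    using assms(1) by simp
  moreover have "quat_of (0 :: 'a) = 0" by (simp add: quat_of_def zero_quat_def)
  ultimately show ?thesis
    using assms(2,3) by (simp add: scalar_bipoly_def lookup_poly_mapping_map lookup_biquadratic_poly quat_of_inject)
qed

lemma mult_quat_conj_self: "x * quat_conj x = quat_of (qdot x x)"
  by (simp add: qdot_def quat_of_def quat_conj_def times_quat_def algebra_simps)

text \<open>Polarized norm: the mixed products in $Q Q^*$ pair up to scalars, whence the factors 2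
  in \<open>norm_coeff\<close>.\<close>

lemma quat_of_double_qdot: "quat_of (2 * qdot x y) = x * quat_conj y + y * quat_conj x"
  by (simp add: qdot_def quat_of_def quat_conj_def times_quat_def plus_quat_def algebra_simps)

lemma bilinear_poly_mult_conj:
  "bilinear_poly a b c d * conj_bipoly (bilinear_poly a b c d) = scalar_bipoly (biquadratic_poly (norm_coeff a b c d))"
  unfolding bilinear_poly_def biquadratic_poly_def numeral_2_eq_2 One_nat_def
  by (simp add: conj_bipoly_add conj_bipoly_single scalar_bipoly_add scalar_bipoly_single
      distrib_left distrib_right mult_single quat_of_add quat_of_double_qdot single_add add_ac
      flip: mult_quat_conj_self)

lemma qdot_bilinear:
  "qdot (x + y) z = qdot x z + qdot y z" "qdot z (x + y) = qdot z x + qdot z y"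
  "qdot (quat_scale k x) y = k * qdot x y" "qdot x (quat_scale k y) = k * qdot x y"
  by (simp_all add: qdot_def quat_scale_def plus_quat_def algebra_simps)

lemma qdot_map_of_real:
  "qdot (map_quat complex_of_real x) (map_quat complex_of_real y) = of_real (qdot x y)"
  by (simp add: qdot_def quat.map_sel)

lemma eval_at_bilinear_poly:
  "eval_at (complexify (bilinear_poly a b c d)) s t =
     (map_quat of_real a + quat_scale t (map_quat of_real c))
     + quat_scale s (map_quat of_real b + quat_scale t (map_quat of_real d))"
  by (simp add: bilinear_poly_def complexify_add complexify_single eval_at_add eval_at_single
      cquat.scale_right_distrib add_ac)

lemma qdot_eval_at_bilinear_poly:
  fixes a b c d :: "real quat"
  defines "n \<equiv> \<lambda>i j. complex_of_real (norm_coeff a b c d i j)"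
  shows "qdot (eval_at (complexify (bilinear_poly a b c d)) s t) (eval_at (complexify (bilinear_poly a b c d)) s t)
    = (n 0 0 + n 0 1 * t + n 0 2 * t\<^sup>2) + (n 1 0 + n 1 1 * t + n 1 2 * t\<^sup>2) * s
      + (n 2 0 + n 2 1 * t + n 2 2 * t\<^sup>2) * s\<^sup>2"
  unfolding n_def eval_at_bilinear_poly qdot_bilinear qdot_map_of_real numeral_2_eq_2 One_nat_def norm_coeff.simps
  by (simp add: qdot_commute[of b a] qdot_commute[of c a] qdot_commute[of c b] qdot_commute[of d a]
      qdot_commute[of d b] qdot_commute[of d c] algebra_simps)

section \<open>Non-real roots and primitivity\<close>

lemma real_quadratic_nonreal_root:
  fixes u0 u1 u2 :: real
  assumes "of_real u0 + of_real u1 * p + of_real u2 * p\<^sup>2 = 0" "p \<notin> \<real>"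
  shows "u1 = - 2 * Re p * u2" "u0 = (cmod p)\<^sup>2 * u2"
proof -
  have "Im p \<noteq> 0" using assms(2) by (simp add: complex_is_Real_iff)
  have "u1 * Im p + u2 * (2 * Re p * Im p) = 0"
    using arg_cong[OF assms(1), of Im] by (simp add: power2_eq_square mult_ac)
  then have "(u1 + 2 * Re p * u2) * Im p = 0" by (simp add: algebra_simps)
  with \<open>Im p \<noteq> 0\<close> show u1: "u1 = - 2 * Re p * u2" by simp
  have "u0 + u1 * Re p + u2 * ((Re p)\<^sup>2 - (Im p)\<^sup>2) = 0"
    using arg_cong[OF assms(1), of Re] by (simp add: power2_eq_square algebra_simps)
  with u1 have "u0 = ((Re p)\<^sup>2 + (Im p)\<^sup>2) * u2"
    by (simp add: power2_eq_square algebra_simps)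
  then show "u0 = (cmod p)\<^sup>2 * u2" by (simp add: cmod_power2)
qed

lemma complex_quadratic_zero:
  fixes u0 u1 u2 :: complex
  assumes "\<And>s. u0 + u1 * s + u2 * s\<^sup>2 = 0"
  shows "u0 = 0" "u1 = 0" "u2 = 0"
proof -
  have "u0 = 0" "u0 + u1 + u2 = 0" "u0 - u1 + u2 = 0"
    using assms[of 0] assms[of 1] assms[of "- 1"] by simp_all
  then show "u0 = 0" "u1 = 0" "u2 = 0" by algebra+
qed

text \<open>The quadratic is the norm of $z + w x$. Its discriminant is $-4D$ with the Gram
  determinant $D$ of \<open>z\<close> and \<open>w\<close>; by Cauchy-Schwarz $D$ is non-negative,
  and it vanishes only for parallel vectors.\<close>

lemma exists_nonreal_root_or_parallel:
  fixes z w :: "real quat"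
  assumes "w \<noteq> 0"
  obtains (parallel) r where "z = quat_scale r w"
  | (root) p where "p \<notin> \<real>"
      "complex_of_real (qdot z z) + of_real (2 * qdot z w) * p + of_real (qdot w w) * p\<^sup>2 = 0"
proof -
  define n k m D where "n = qdot w w" "k = qdot z z" "m = qdot z w" "D = n * k - m\<^sup>2"
  note defs = this
  have n: "n > 0"
    using assms qdot_self_eq_0_iff[of w] qdot_self_nonneg[of w] unfolding defs by linarith
  \<comment> \<open>\<open>e\<close> is \<open>n\<close> times the component of \<open>z\<close>
    orthogonal to \<open>w\<close>; its norm proves Cauchy-Schwarz together with the case of
    equality.\<close>
  define e where "e = quat_scale n z + quat_scale (- m) w"
  have eD: "qdot e e = n * D"
    unfolding e_def qdot_bilinear defs by (simp add: qdot_commute[of w z] algebra_simps power2_eq_square)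
  then have "D \<ge> 0"
    using n qdot_self_nonneg[of e] by (simp add: zero_le_mult_iff)
  show ?thesis
  proof (cases "D = 0")
    case True
    then have "e = 0" using eD by (simp add: qdot_self_eq_0_iff)
    then have "z = quat_scale (m / n) w"
      using n by (intro quat.expand) (simp add: e_def quat_scale_def plus_quat_def zero_quat_def field_simps)
    then show ?thesis by (rule parallel)
  next
    case False
    with \<open>D \<ge> 0\<close> have D: "D > 0" by simp
    \<comment> \<open>The root with positive imaginary part from the quadratic formula.\<close>
    define p where "p = Complex (- m / n) (sqrt D / n)"
    have "p \<notin> \<real>" using D n by (simp add: p_def complex_is_Real_iff)
    have "k + 2 * m * (- m / n) + n * ((m / n)\<^sup>2 - D / n\<^sup>2) = 0"
      using n by (simp add: defs(4) field_simps power2_eq_square)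
    moreover have "Re (p\<^sup>2) = (m / n)\<^sup>2 - D / n\<^sup>2"
      using D by (simp add: Re_power2 p_def power_divide)
    moreover have "Im (p\<^sup>2) = - 2 * m * sqrt D / n\<^sup>2"
      by (simp add: Im_power2 p_def power2_eq_square)
    then have "2 * m * Im p + n * Im (p\<^sup>2) = 0"
      using n by (simp add: p_def power2_eq_square)
    ultimately have "complex_of_real k + of_real (2 * m) * p + of_real n * p\<^sup>2 = 0"
      by (intro complex_eqI) (simp_all add: p_def)
    with \<open>p \<notin> \<real>\<close> show ?thesis using root[of p] by (simp add: defs)
  qed
qed

text \<open>Here $Q = (t + r)(c + d s)$ with a scalar first factor.\<close>

lemma not_primitive_factor_t:
  assumes "a = quat_scale r c" "b = quat_scale r d"
  shows "\<not> primitive (complexify (bilinear_poly a b c d))"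
proof -
  let ?f = "\<lambda>j::nat. if j = 0 then complex_of_real r else 1"
  let ?P = "\<Sum>j\<le>1. Poly_Mapping.single (0, j) (?f j)"
  let ?C = "map_quat complex_of_real"
  have "deg_t ?P = 1" by (rule deg_t_sum) simp
  then have "bidegree ?P \<noteq> (0, 0)" by (simp add: bidegree_def)
  moreover have "?C (quat_scale r x) = quat_of (of_real r) * ?C x" for x
    by (simp add: quat_scale_def quat.map_sel quat_of_def times_quat_def)
  moreover have "quat_of 1 = (1 :: complex quat)" by (simp add: quat_of_def one_quat_def)
  ultimately have "complexify (bilinear_poly a b c d)
      = scalar_bipoly ?P * (Poly_Mapping.single (0, 0) (?C c) + Poly_Mapping.single (1, 0) (?C d))"
    by (simp add: assms bilinear_poly_def complexify_add complexify_single scalar_bipoly_add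
        scalar_bipoly_single mult_single distrib_left distrib_right add_ac)
  with \<open>bidegree ?P \<noteq> (0, 0)\<close> show ?thesis unfolding primitive_def by blast
qed

text \<open>Here $Q = (s + r)(b + d t)$ with a scalar first factor.\<close>

lemma not_primitive_factor_s:
  assumes "a = quat_scale r b" "c = quat_scale r d"
  shows "\<not> primitive (complexify (bilinear_poly a b c d))"
proof -
  let ?f = "\<lambda>j::nat. if j = 0 then complex_of_real r else 1"
  let ?P = "\<Sum>j\<le>1. Poly_Mapping.single (j, 0) (?f j)"
  let ?C = "map_quat complex_of_real"
  have "deg_s ?P = 1" by (rule deg_s_sum) simp
  then have "bidegree ?P \<noteq> (0, 0)" by (simp add: bidegree_def)
  moreover have "?C (quat_scale r x) = quat_of (of_real r) * ?C x" for x
    by (simp add: quat_scale_def quat.map_sel quat_of_def times_quat_def)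
  moreover have "quat_of 1 = (1 :: complex quat)" by (simp add: quat_of_def one_quat_def)
  ultimately have "complexify (bilinear_poly a b c d)
      = scalar_bipoly ?P * (Poly_Mapping.single (0, 0) (?C b) + Poly_Mapping.single (0, 1) (?C d))"
    by (simp add: assms bilinear_poly_def complexify_add complexify_single scalar_bipoly_add
        scalar_bipoly_single mult_single distrib_left distrib_right add_ac)
  with \<open>bidegree ?P \<noteq> (0, 0)\<close> show ?thesis unfolding primitive_def by blast
qed

lemma linear_product:
  "(\<Sum>i\<le>1. Poly_Mapping.single (i, 0) (f i)) * (\<Sum>j\<le>1. Poly_Mapping.single (0, j) (g j))
     = bilinear_poly (f 0 * g 0) (f 1 * g 0) (f 0 * g 1) (f 1 * g 1 :: 'a::comm_ring_1 quat)"
  "(\<Sum>j\<le>1. Poly_Mapping.single (0, j) (g j)) * (\<Sum>i\<le>1. Poly_Mapping.single (i, 0) (f i))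
     = bilinear_poly (g 0 * f 0) (g 0 * f 1) (g 1 * f 0) (g 1 * f 1)"
  by (simp_all add: bilinear_poly_def mult_single distrib_left distrib_right add_ac)

lemma bilinear_poly_inject:
  "bilinear_poly a b c d = bilinear_poly a' b' c' d' \<longleftrightarrow> a = a' \<and> b = b' \<and> c = c' \<and> d = d'"
proof
  assume "bilinear_poly a b c d = bilinear_poly a' b' c' d'"
  then have "Poly_Mapping.lookup (bilinear_poly a b c d) k = Poly_Mapping.lookup (bilinear_poly a' b' c' d') k" for k
    by simp
  from this[of "(0, 0)"] this[of "(1, 0)"] this[of "(0, 1)"] this[of "(1, 1)"]
  show "a = a' \<and> b = b' \<and> c = c' \<and> d = d'"
    by (simp add: bilinear_poly_def lookup_add lookup_single when_def)
qed simp

text \<open>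
  With two arguments zero, \<open>norm_coeff\<close> gives the coefficients of the norms of the linear
  polynomials $x + y s$ and $z + w t$.
\<close>

lemma norm_coeff_mult:
  fixes x y z w :: "'a::comm_ring_1 quat"
  shows "norm_coeff (x * z) (y * z) (x * w) (y * w) i j = norm_coeff x y 0 0 i 0 * norm_coeff z 0 w 0 0 j"
    and "norm_coeff (z * x) (z * y) (w * x) (w * y) i j = norm_coeff x y 0 0 i 0 * norm_coeff z 0 w 0 0 j"
  by (cases "(x, y, z, w, i, j)" rule: norm_coeff.cases;
      simp add: qdot_def times_quat_def zero_quat_def algebra_simps)+

section \<open>The three implications\<close>

text \<open>From (i) to (iii). Each row of the matrix of norm coefficients is a real quadratic in
  $t$ with root \<open>p\<close>, each column one in $s$ with root \<open>q\<close>. All rows are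
  thus proportional to one quadratic and all columns to another, so the matrix is a product.\<close>

lemma norm_eq_product_of_nonreal_roots:
  fixes a b c d :: "real quat"
  assumes "b \<noteq> 0 \<or> d \<noteq> 0" "p \<notin> \<real>" "q \<notin> \<real>"
    and p: "\<And>s. qdot (eval_at (complexify (bilinear_poly a b c d)) s p) (eval_at (complexify (bilinear_poly a b c d)) s p) = 0"
    and q: "\<And>t. qdot (eval_at (complexify (bilinear_poly a b c d)) q t) (eval_at (complexify (bilinear_poly a b c d)) q t) = 0"
  shows "\<exists>A B :: real bipoly. A \<in> polys_in_s \<and> deg_s A = 2 \<and> B \<in> polys_in_t \<and> deg_t B = 2 \<and>
     bilinear_poly a b c d * conj_bipoly (bilinear_poly a b c d) = scalar_bipoly A * scalar_bipoly B"
proof -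
  let ?n = "norm_coeff a b c d"
  have le2: "i \<le> 2 \<longleftrightarrow> i = 0 \<or> i = 1 \<or> i = 2" for i :: nat
    by auto
  have row: "?n i 1 = - 2 * Re p * ?n i 2 \<and> ?n i 0 = (cmod p)\<^sup>2 * ?n i 2" if "i \<le> 2" for i
  proof -
    have "of_real (?n i 0) + of_real (?n i 1) * p + of_real (?n i 2) * p\<^sup>2 = 0"
      using that complex_quadratic_zero[OF p[unfolded qdot_eval_at_bilinear_poly]] unfolding le2 by blast
    from real_quadratic_nonreal_root[OF this \<open>p \<notin> \<real>\<close>] show ?thesis by simp
  qed
  have col: "?n 1 j = - 2 * Re q * ?n 2 j \<and> ?n 0 j = (cmod q)\<^sup>2 * ?n 2 j" if "j \<le> 2" for j
  proof -
    \<comment> \<open>The same norm regrouped by powers of $t$.\<close>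
    have "(of_real (?n 0 0) + of_real (?n 1 0) * q + of_real (?n 2 0) * q\<^sup>2)
        + (of_real (?n 0 1) + of_real (?n 1 1) * q + of_real (?n 2 1) * q\<^sup>2) * t
        + (of_real (?n 0 2) + of_real (?n 1 2) * q + of_real (?n 2 2) * q\<^sup>2) * t\<^sup>2 = 0" for t
      using q[of t] unfolding qdot_eval_at_bilinear_poly by (simp add: algebra_simps)
    from complex_quadratic_zero[OF this]
    have "of_real (?n 0 j) + of_real (?n 1 j) * q + of_real (?n 2 j) * q\<^sup>2 = 0"
      using that unfolding le2 by blast
    from real_quadratic_nonreal_root[OF this \<open>q \<notin> \<real>\<close>] show ?thesis by simp
  qed
  \<comment> \<open>Otherwise the whole row of $s^2$ vanishes, including the norms of
    \<open>b\<close> and \<open>d\<close>.\<close>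
  have "?n 2 2 \<noteq> 0"
  proof
    assume "?n 2 2 = 0"
    with row[of 2] have "?n 2 0 = 0" by simp
    with \<open>?n 2 2 = 0\<close> have "b = 0" "d = 0"
      by (simp_all add: numeral_2_eq_2 qdot_self_eq_0_iff)
    with assms(1) show False by blast
  qed
  \<comment> \<open>\<open>g\<close> is the minimal polynomial of \<open>p\<close>; \<open>f\<close>
    is that of \<open>q\<close>, scaled by the leading coefficient of the norm.\<close>
  define f where "f i = (if i = 0 then (cmod q)\<^sup>2 else if i = 1 then - 2 * Re q else 1) * ?n 2 2" for i :: nat
  define g where "g j = (if j = 0 then (cmod p)\<^sup>2 else if j = 1 then - 2 * Re p else 1)" for j :: nat
  have "?n i j = f i * g j" if "i \<le> 2" "j \<le> 2" for i j
  proof -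
    consider "j = 0" | "j = 1" | "j = 2" using \<open>j \<le> 2\<close> by linarith
    then have "?n i j = ?n i 2 * g j"
      using row[OF \<open>i \<le> 2\<close>] by cases (simp_all add: g_def)
    moreover consider "i = 0" | "i = 1" | "i = 2" using \<open>i \<le> 2\<close> by linarith
    then have "?n i 2 = f i"
      using col[of 2] by cases (simp_all add: f_def)
    ultimately show ?thesis by simp
  qed
  then have "biquadratic_poly ?n = biquadratic_poly (\<lambda>i j. f i * g j)"
    unfolding biquadratic_poly_def by (intro sum.cong refl) simp
  then have "bilinear_poly a b c d * conj_bipoly (bilinear_poly a b c d)
    = scalar_bipoly (\<Sum>i\<le>2. Poly_Mapping.single (i, 0) (f i)) * scalar_bipoly (\<Sum>j\<le>2. Poly_Mapping.single (0, j) (g j))"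
    by (simp add: bilinear_poly_mult_conj scalar_bipoly_mult_univariate)
  moreover have "f 2 \<noteq> 0" "g 2 \<noteq> 0"
    using \<open>?n 2 2 \<noteq> 0\<close> by (simp_all add: f_def g_def)
  ultimately show ?thesis
    using sum_in_polys_in_s sum_in_polys_in_t deg_s_sum[of f 2] deg_t_sum[of g 2] by blast
qed

text \<open>From (iii) to (ii): divide by \<open>d\<close> on the right, apply
  \<open>monic_factor\<close>, and give \<open>d\<close> back to the right-hand factor.\<close>

lemma factor_of_norm_eq_product:
  fixes a b c d :: "real quat" and A B :: "real bipoly"
  assumes "A \<in> polys_in_s" "deg_s A = 2" "B \<in> polys_in_t" "deg_t B = 2"
    and "bilinear_poly a b c d * conj_bipoly (bilinear_poly a b c d) = scalar_bipoly A * scalar_bipoly B"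
  shows "\<exists>S T :: real quat bipoly. S \<in> polys_in_s \<and> deg_s S = 1 \<and> T \<in> polys_in_t \<and> deg_t T = 1 \<and>
     bilinear_poly a b c d \<in> {S * T, T * S}"
proof -
  let ?n = "norm_coeff a b c d"
  obtain f where f: "A = (\<Sum>i\<le>2. Poly_Mapping.single (i, 0) (f i))" "f 2 \<noteq> 0"
    using polys_in_s_degE[OF assms(1,2)] by auto
  obtain g where g: "B = (\<Sum>i\<le>2. Poly_Mapping.single (0, i) (g i))" "g 2 \<noteq> 0"
    using polys_in_t_degE[OF assms(3,4)] by auto
  have n: "?n i j = f i * g j" if "i \<le> 2" "j \<le> 2" for i j
    using assms(5) that unfolding f g bilinear_poly_mult_conj scalar_bipoly_mult_univariate
    by (rule scalar_biquadratic_poly_eqD)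
  \<comment> \<open>Vanishing 2-by-2 minors: this eliminates the unknown \<open>f\<close> and
    \<open>g\<close>.\<close>
  then have rank1: "?n i j * ?n 2 2 = ?n i 2 * ?n 2 j" if "i \<le> 2" "j \<le> 2" for i j
    using that by (simp add: mult_ac)
  have "?n 2 2 \<noteq> 0" using n[of 2 2] f g by simp
  then have N: "qdot d d \<noteq> 0" by (simp add: numeral_2_eq_2)
  then have "d \<noteq> 0" by (simp add: qdot_self_eq_0_iff)
  obtain a' where a: "a = a' * d" using real_quat_right_divide[OF \<open>d \<noteq> 0\<close>] .
  obtain b' where b: "b = b' * d" using real_quat_right_divide[OF \<open>d \<noteq> 0\<close>] .
  obtain c' where c: "c = c' * d" using real_quat_right_divide[OF \<open>d \<noteq> 0\<close>] .
  have d1: "qdot (x * d) d = qdot x 1 * qdot d d" for x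
    using qdot_mult_right[of x d 1] by simp
  have "a' = c' * b' \<or> a' = b' * c'"
  proof (rule monic_factor)
    show "qdot a' 1 + qdot b' c' = 2 * qdot b' 1 * qdot c' 1"
    proof -
      \<comment> \<open>The factor collects the 2 in the mixed coefficients and one norm of
        \<open>d\<close> from each side of the minor's products.\<close>
      have "(qdot a' 1 + qdot b' c') * (2 * (qdot d d)\<^sup>2) = 2 * qdot b' 1 * qdot c' 1 * (2 * (qdot d d)\<^sup>2)"
        using rank1[of 1 1] unfolding numeral_2_eq_2 One_nat_def norm_coeff.simps a b c qdot_mult_right d1
        by (simp add: algebra_simps)
      with N show ?thesis by simp
    qed
    show "qdot a' b' = qdot b' b' * qdot c' 1"
      using rank1[of 1 0] N unfolding numeral_2_eq_2 One_nat_def norm_coeff.simps a b c qdot_mult_right d1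
      by (simp add: field_simps)
    show "qdot a' c' = qdot c' c' * qdot b' 1"
      using rank1[of 0 1] N unfolding numeral_2_eq_2 One_nat_def norm_coeff.simps a b c qdot_mult_right d1
      by (simp add: field_simps)
    show "qdot a' a' = qdot b' b' * qdot c' c'"
      using rank1[of 0 0] N unfolding numeral_2_eq_2 One_nat_def norm_coeff.simps a b c qdot_mult_right d1
      by (simp add: field_simps)
  qed
  then show ?thesis
  proof
    assume a': "a' = c' * b'"
    \<comment> \<open>$Q = (s + c')(b + d t)$.\<close>
    define F G where "F i = (if i = 0 then c' else 1)" and "G i = (if i = 0 then b else d)" for i :: nat
    have "bilinear_poly a b c d
      = (\<Sum>i\<le>1. Poly_Mapping.single (i, 0) (F i)) * (\<Sum>j\<le>1. Poly_Mapping.single (0, j) (G j))"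
      unfolding linear_product by (simp add: F_def G_def a b c a' mult.assoc)
    moreover have "F 1 \<noteq> 0" "G 1 \<noteq> 0"
      using \<open>d \<noteq> 0\<close> by (simp_all add: F_def G_def one_quat_def zero_quat_def)
    ultimately show ?thesis
      using sum_in_polys_in_s sum_in_polys_in_t deg_s_sum[of F 1] deg_t_sum[of G 1] by blast
  next
    assume a': "a' = b' * c'"
    \<comment> \<open>$Q = (t + b')(c + d s)$.\<close>
    define F G where "F i = (if i = 0 then c else d)" and "G i = (if i = 0 then b' else 1)" for i :: nat
    have "bilinear_poly a b c d
      = (\<Sum>j\<le>1. Poly_Mapping.single (0, j) (G j)) * (\<Sum>i\<le>1. Poly_Mapping.single (i, 0) (F i))"
      unfolding linear_product by (simp add: F_def G_def a b c a' mult.assoc)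
    moreover have "F 1 \<noteq> 0" "G 1 \<noteq> 0"
      using \<open>d \<noteq> 0\<close> by (simp_all add: F_def G_def one_quat_def zero_quat_def)
    ultimately show ?thesis
      using sum_in_polys_in_s sum_in_polys_in_t deg_s_sum[of F 1] deg_t_sum[of G 1] by blast
  qed
qed

text \<open>From (ii) to the roots in (i): the norm of $Q$ is the product of the norms of $x + y s$
  and $z + w t$, in either order of the factors. A non-real root of one norm annihilates the product
  for all values of the other variable.\<close>

lemma nonreal_roots_of_factor:
  fixes x y z w :: "real quat"
  assumes prim: "primitive (complexify (bilinear_poly a b c d))" and "y \<noteq> 0" "w \<noteq> 0"
    and eq: "a = x * z \<and> b = y * z \<and> c = x * w \<and> d = y * w \<or> a = z * x \<and> b = z * y \<and> c = w * x \<and> d = w * y"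
  obtains p q where "p \<notin> \<real>" "q \<notin> \<real>"
    "\<And>s. qdot (eval_at (complexify (bilinear_poly a b c d)) s p) (eval_at (complexify (bilinear_poly a b c d)) s p) = 0"
    "\<And>t. qdot (eval_at (complexify (bilinear_poly a b c d)) q t) (eval_at (complexify (bilinear_poly a b c d)) q t) = 0"
proof -
  let ?\<sigma> = "\<lambda>s. complex_of_real (qdot x x) + of_real (2 * qdot x y) * s + of_real (qdot y y) * s\<^sup>2"
  let ?\<tau> = "\<lambda>t. complex_of_real (qdot z z) + of_real (2 * qdot z w) * t + of_real (qdot w w) * t\<^sup>2"
  have prod: "qdot (eval_at (complexify (bilinear_poly a b c d)) s t) (eval_at (complexify (bilinear_poly a b c d)) s t)
      = ?\<sigma> s * ?\<tau> t" for s t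
  proof -
    have n: "norm_coeff a b c d i j = norm_coeff x y 0 0 i 0 * norm_coeff z 0 w 0 0 j" for i j
      using eq norm_coeff_mult by metis
    show ?thesis
      unfolding qdot_eval_at_bilinear_poly n by (simp add: numeral_2_eq_2 algebra_simps)
  qed
  have scale: "quat_scale r u * v = quat_scale r (u * v)" "u * quat_scale r v = quat_scale r (u * v)"
    for r and u v :: "real quat"
    by (simp_all add: quat_scale_def times_quat_def algebra_simps)
  obtain p where "p \<notin> \<real>" "?\<tau> p = 0"
  proof (rule exists_nonreal_root_or_parallel[OF \<open>w \<noteq> 0\<close>, of z])
    \<comment> \<open>In the parallel case $Q$ has the real factor $t + r$, contradicting
      primitivity.\<close>
    fix r assume "z = quat_scale r w"
    then have "a = quat_scale r c" "b = quat_scale r d" using eq by (auto simp: scale)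
    then show ?thesis using prim not_primitive_factor_t by blast
  qed blast
  moreover obtain q where "q \<notin> \<real>" "?\<sigma> q = 0"
  proof (rule exists_nonreal_root_or_parallel[OF \<open>y \<noteq> 0\<close>, of x])
    fix r assume "x = quat_scale r y"
    then have "a = quat_scale r b" "c = quat_scale r d" using eq by (auto simp: scale)
    then show ?thesis using prim not_primitive_factor_s by blast
  qed blast
  ultimately show ?thesis using that[of p q] by (simp add: prod)
qed

theorem corollary2:
  fixes Q :: "real quat bipoly"
  assumes "primitive (complexify Q)"
    and "bidegree Q = (1, 1)"
  shows
    "((\<exists>p q :: complex. p \<notin> \<real> \<and> q \<notin> \<real> \<and>
         value_closure (range (\<lambda>s. eval_at (complexify Q) s p)) \<subseteq> null_quadric \<and>
         value_closure (range (\<lambda>t. eval_at (complexify Q) q t)) \<subseteq> null_quadric \<and>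
         (\<exists>L. proj_line L \<and> value_closure (range (\<lambda>s. eval_at (complexify Q) s p)) \<subseteq> L) \<and>
         (\<exists>L. proj_line L \<and> value_closure (range (\<lambda>t. eval_at (complexify Q) q t)) \<subseteq> L))
      \<longleftrightarrow>
      (\<exists>S T :: real quat bipoly.
         S \<in> polys_in_s \<and> deg_s S = 1 \<and> T \<in> polys_in_t \<and> deg_t T = 1 \<and> Q \<in> {S * T, T * S}))
     \<and>
     ((\<exists>S T :: real quat bipoly.
         S \<in> polys_in_s \<and> deg_s S = 1 \<and> T \<in> polys_in_t \<and> deg_t T = 1 \<and> Q \<in> {S * T, T * S})
      \<longleftrightarrow>
      (\<exists>A B :: real bipoly.
         A \<in> polys_in_s \<and> deg_s A = 2 \<and> B \<in> polys_in_t \<and> deg_t B = 2 \<and>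
         Q * conj_bipoly Q = scalar_bipoly A * scalar_bipoly B))"
    (is "(?I \<longleftrightarrow> ?II) \<and> (?II \<longleftrightarrow> ?III)")
proof -
  obtain a b c d where Q: "Q = bilinear_poly a b c d" and bd: "b \<noteq> 0 \<or> d \<noteq> 0"
    using bidegree_1_1E[OF assms(2)] unfolding bilinear_poly_def by metis
  \<comment> \<open>The implications are proved in the cycle (i), (iii), (ii), (i).\<close>
  have "?III" if "?I"
  proof -
    from that obtain p q where pq: "p \<notin> \<real>" "q \<notin> \<real>"
      and "value_closure (range (\<lambda>s. eval_at (complexify Q) s p)) \<subseteq> null_quadric"
        "value_closure (range (\<lambda>t. eval_at (complexify Q) q t)) \<subseteq> null_quadric"
      by blast
    then show ?thesis
      unfolding Q by (intro norm_eq_product_of_nonreal_roots[OF bd pq]) (simp_all add: value_closure_subset_iff_null)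
  qed
  moreover have "?II" if "?III"
    using that factor_of_norm_eq_product unfolding Q by blast
  moreover have "?I" if "?II"
  proof -
    from that obtain S T :: "real quat bipoly" where ST: "S \<in> polys_in_s" "deg_s S = 1" "T \<in> polys_in_t" "deg_t T = 1"
      and QST: "Q = S * T \<or> Q = T * S" by blast
    obtain f where f: "S = (\<Sum>i\<le>1. Poly_Mapping.single (i, 0) (f i))" "f 1 \<noteq> 0"
      using polys_in_s_degE[OF ST(1,2)] by auto
    obtain g where g: "T = (\<Sum>i\<le>1. Poly_Mapping.single (0, i) (g i))" "g 1 \<noteq> 0"
      using polys_in_t_degE[OF ST(3,4)] by auto
    have "a = f 0 * g 0 \<and> b = f 1 * g 0 \<and> c = f 0 * g 1 \<and> d = f 1 * g 1
        \<or> a = g 0 * f 0 \<and> b = g 0 * f 1 \<and> c = g 1 * f 0 \<and> d = g 1 * f 1"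
      using QST unfolding Q f(1) g(1) linear_product bilinear_poly_inject .
    from nonreal_roots_of_factor[OF assms(1)[unfolded Q] f(2) g(2) this]
    obtain p q where pq: "p \<notin> \<real>" "q \<notin> \<real>"
      and null: "\<And>s. qdot (eval_at (complexify Q) s p) (eval_at (complexify Q) s p) = 0"
        "\<And>t. qdot (eval_at (complexify Q) q t) (eval_at (complexify Q) q t) = 0"
      unfolding Q by metis
    have "\<exists>L. proj_line L \<and> value_closure (range (\<lambda>s. eval_at (complexify Q) s p)) \<subseteq> L"
      unfolding Q eval_at_bilinear_poly by (rule value_closure_affine_line)
    \<comment> \<open>The value is regrouped as an affine function of $t$, as needed for the second
      line.\<close>
    moreover have "eval_at (complexify Q) q t
        = (map_quat of_real a + quat_scale q (map_quat of_real b))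
          + quat_scale t (map_quat of_real c + quat_scale q (map_quat of_real d))" for t
      unfolding Q eval_at_bilinear_poly by (simp add: cquat.scale_right_distrib mult_ac add_ac)
    then have "\<exists>L. proj_line L \<and> value_closure (range (\<lambda>t. eval_at (complexify Q) q t)) \<subseteq> L"
      by (simp only: value_closure_affine_line)
    ultimately show ?thesis
      using pq null by (intro exI[of _ p] exI[of _ q]) (simp add: value_closure_subset_iff_null)
  qed
  ultimately show ?thesis by blast
qed

end
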